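(* Let $a>0$, $b>0$. Let $N(t)$, $t\ge 0$, be a homogeneous Poisson process with parameter $1$. For each $\gamma>0$ let $Y^*_j$, $j\ge 0$, be i.i.d. random variables, independent of $N$, with probability density function $$\nu^*_Y(y)=\tfrac12\,\nu_Y(-y)+\tfrac12\,\nu_Y(y),\quad y\in\mathbb{R},\qquad \nu_Y(y)=\frac{e^{-\sqrt{b}\,y}}{y}\,\frac{1}{E_1(\sqrt{b}\,\gamma)}\,\mathbf{1}_{y\ge\gamma}.$$ Then, for every $t\ge 0$, $$\sum_{j=0}^{N(t\,a\,E_1(\sqrt{b}\,\gamma))} Y^*_j\ \longrightarrow\ X_{t/2}\quad\text{in law as }\gamma\to 0,$$ where $X$ is the Variance Gamma process with parameters $a,b$.
   Context: $E_1(x)=\int_x^\infty \frac{e^{-z}}{z}\,dz$, $x>0$, is the exponential integral. **Variance Gamma process.** Let $H=\{H_t,t\ge 0\}$ be the Gamma subordinator started at $0$ with $\mathbf{E}[e^{-\lambda H_t}]=e^{-t\,a\ln(1+\lambda/b)}$ for $\lambda>0$. Let $B=\{B_t,t\ge0\}$ be a one-dimensional Brownian motion started at $0$, independent of $H$, with density $g(t,x)=e^{-x^2/(4t)}/\sqrt{4\pi t}$ (so $B_t$ has variance $2t$). The Variance Gamma process is $X_t=B_{H_t}$, $t\ge0$. The variables $Y_j^*$ are distributed as $Y^*=\epsilon Y$, where $Y$ has density $\nu_Y$ and $\epsilon$ is an independent Rademacher variable ($\mathbf{P}(\epsilon=\pm1)=\tfrac12$). Their law depends on $\gamma$. *)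

theory Defs
  imports "HOL-Probability.Probability"
begin

definition E1 :: "real \<Rightarrow> real" where
  "E1 x = (LBINT z=ereal x..\<infinity>. exp (- z) / z)"

definition nu_Y :: "real \<Rightarrow> real \<Rightarrow> real \<Rightarrow> real" where
  "nu_Y b \<gamma> y = exp (- sqrt b * y) / y * (1 / E1 (sqrt b * \<gamma>)) * indicator {\<gamma>..} y"

definition nu_Y_star :: "real \<Rightarrow> real \<Rightarrow> real \<Rightarrow> real" where
  "nu_Y_star b \<gamma> y = 1 / 2 * nu_Y b \<gamma> (- y) + 1 / 2 * nu_Y b \<gamma> y"

text \<open>
  The library's \<open>weak_conv_m\<close> is restricted to sequences of distributions; the parameter here
  tends to a limit along an arbitrary filter.
\<close>

definition weak_conv_filter :: "('i \<Rightarrow> real measure) \<Rightarrow> real measure \<Rightarrow> 'i filter \<Rightarrow> bool" where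
  "weak_conv_filter Ms M F \<longleftrightarrow>
     (\<forall>x. isCont (cdf M) x \<longrightarrow> ((\<lambda>i. cdf (Ms i) x) \<longlongrightarrow> cdf M x) F)"

lemma weak_conv_filter_sequentially: "weak_conv_filter Ms M sequentially \<longleftrightarrow> weak_conv_m Ms M"
  by (simp add: weak_conv_filter_def weak_conv_m_def weak_conv_def)

text \<open>
  Continuous-time processes are functions \<open>real \<Rightarrow> 'a \<Rightarrow> _\<close> of which only the times \<open>t \<ge> 0\<close> are
  constrained. Path properties are required of every path, not almost every path: \<open>M\<close> need not be
  complete, and continuity of all paths of \<open>B\<close> is what makes \<open>\<lambda>\<omega>. B (H t \<omega>) \<omega>\<close> measurable.
\<close>

context prob_space
begin

definition process_events :: "'i set \<Rightarrow> ('i \<Rightarrow> 'a \<Rightarrow> 'b::topological_space) \<Rightarrow> 'a set set" where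
  "process_events T X =
     sigma_sets (space M) {X t -` A \<inter> space M | t A. t \<in> T \<and> A \<in> sets borel}"

definition levy_process :: "(real \<Rightarrow> 'a \<Rightarrow> real) \<Rightarrow> bool" where
  "levy_process X \<longleftrightarrow>
     (\<forall>t\<ge>0. random_variable borel (X t)) \<and>
     (\<forall>\<omega>\<in>space M. X 0 \<omega> = 0) \<and>
     (\<forall>n (s :: nat \<Rightarrow> real). 0 \<le> s 0 \<and> mono_on {..n} s \<longrightarrow>
        indep_vars (\<lambda>_. borel) (\<lambda>i \<omega>. X (s (Suc i)) \<omega> - X (s i) \<omega>) {..<n}) \<and>
     (\<forall>s\<ge>0. \<forall>t\<ge>s. distr M borel (\<lambda>\<omega>. X t \<omega> - X s \<omega>) = distr M borel (X (t - s))) \<and>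
     (\<forall>\<omega>\<in>space M. \<forall>t\<ge>0. continuous (at_right t) (\<lambda>s. X s \<omega>)) \<and>
     (\<forall>\<omega>\<in>space M. \<forall>t>0. \<exists>l. ((\<lambda>s. X s \<omega>) \<longlongrightarrow> l) (at_left t))"

definition poisson_process :: "real \<Rightarrow> (real \<Rightarrow> 'a \<Rightarrow> nat) \<Rightarrow> bool" where
  "poisson_process r N \<longleftrightarrow>
     levy_process (\<lambda>t \<omega>. real (N t \<omega>)) \<and>
     (\<forall>\<omega>\<in>space M. mono_on {0..} (\<lambda>t. N t \<omega>)) \<and>
     (\<forall>t>0. distr M (count_space UNIV) (N t) = measure_pmf (poisson_pmf (r * t)))"

definition gamma_subordinator :: "real \<Rightarrow> real \<Rightarrow> (real \<Rightarrow> 'a \<Rightarrow> real) \<Rightarrow> bool" where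
  "gamma_subordinator a b H \<longleftrightarrow>
     levy_process H \<and>
     (\<forall>\<omega>\<in>space M. mono_on {0..} (\<lambda>t. H t \<omega>)) \<and>
     (\<forall>t\<ge>0. \<forall>l>0. expectation (\<lambda>\<omega>. exp (- l * H t \<omega>)) = exp (- t * a * ln (1 + l / b)))"

text \<open>Normalised so that \<open>B t\<close> has variance \<open>2 * t\<close>.\<close>

definition brownian_motion :: "(real \<Rightarrow> 'a \<Rightarrow> real) \<Rightarrow> bool" where
  "brownian_motion B \<longleftrightarrow>
     levy_process B \<and>
     (\<forall>\<omega>\<in>space M. continuous_on {0..} (\<lambda>t. B t \<omega>)) \<and>
     (\<forall>t>0. distributed M lborel (B t) (\<lambda>x. ennreal (exp (- x\<^sup>2 / (4 * t)) / sqrt (4 * pi * t))))"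

definition variance_gamma_process :: "real \<Rightarrow> real \<Rightarrow> (real \<Rightarrow> 'a \<Rightarrow> real) \<Rightarrow> bool" where
  "variance_gamma_process a b X \<longleftrightarrow>
     (\<exists>H B. gamma_subordinator a b H \<and> brownian_motion B \<and>
        indep_set (process_events {0..} H) (process_events {0..} B) \<and>
        (\<forall>t\<ge>0. \<forall>\<omega>\<in>space M. X t \<omega> = B (H t \<omega>) \<omega>))"

end

end

(* Both laws are compared through their characteristic functions and Levy's continuity theorem.
   With c = sqrt b, the variable Y* has characteristic function 1 + I(\<gamma>) / E1 (c \<gamma>), where
   I(\<gamma>) is the integral of exp (- c y) (cos (u y) - 1) / y over y > \<gamma>. The random sum therefore has
   characteristic function (1 + I(\<gamma>) / E1 (c \<gamma>)) exp (t a I(\<gamma>)); the first factor comes from the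
   extra summand j = 0 and tends to 1 because E1 (c \<gamma>) tends to infinity. By a Frullani integral
   I(\<gamma>) tends to - ln (1 + u^2 / b) / 2. Conditioning on H shows that X at time t / 2 has
   characteristic function E exp (- u^2 H) = exp (- (t / 2) a ln (1 + u^2 / b)); since the paths of B
   are continuous, H may be replaced by its values rounded down to a grid, so that the conditioning
   is on a countable partition. *)

theory Submission
  imports Defs
begin

section \<open>Conditioning on an independent natural-number index\<close>

context prob_space
begin

text \<open>Splits the expectation over the events \<open>K \<omega> = k\<close>. The partial sum up
  to \<open>n\<close> is \<open>h (K \<omega>) \<omega>\<close> on \<open>K \<omega> < n\<close> and
  0 elsewhere, so it is bounded by \<open>C\<close> and eventually constant at each point; dominated
  convergence applies.\<close>

lemma sums_expectation_random_index:
  fixes h :: "nat \<Rightarrow> 'a \<Rightarrow> complex"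
  assumes K[measurable]: "K \<in> measurable M (count_space UNIV)"
    and h[measurable]: "\<And>k. h k \<in> borel_measurable M"
    and bound: "\<And>k \<omega>. norm (h k \<omega>) \<le> C"
  shows "(\<lambda>k. expectation (\<lambda>\<omega>. indicator {k} (K \<omega>) * h k \<omega>)) sums expectation (\<lambda>\<omega>. h (K \<omega>) \<omega>)"
proof -
  have [measurable]: "(\<lambda>\<omega>. h (K \<omega>) \<omega>) \<in> borel_measurable M"
    by (rule measurable_compose_countable[OF h K])
  have [measurable]: "(\<lambda>\<omega>. indicator {k} (K \<omega>) :: complex) \<in> borel_measurable M" for k
    by (rule measurable_compose[OF K]) simp
  have int: "integrable M (\<lambda>\<omega>. indicator {k} (K \<omega>) * h k \<omega>)" for k
    using order_trans[OF norm_ge_zero bound]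
    by (intro integrable_const_bound[where B = C]) (auto simp: indicator_def bound norm_mult)
  have partial: "(\<Sum>k<n. indicator {k} (K \<omega>) * h k \<omega>) = (if K \<omega> < n then h (K \<omega>) \<omega> else 0)" for n \<omega>
    by (simp add: indicator_def if_distrib[of "\<lambda>x. x * _"] sum.delta cong: if_cong)
  have "(\<lambda>n. expectation (\<lambda>\<omega>. if K \<omega> < n then h (K \<omega>) \<omega> else 0)) \<longlonglongrightarrow> expectation (\<lambda>\<omega>. h (K \<omega>) \<omega>)"
  proof (rule integral_dominated_convergence[where w = "\<lambda>_. C"])
    show "AE \<omega> in M. (\<lambda>n. if K \<omega> < n then h (K \<omega>) \<omega> else 0) \<longlonglongrightarrow> h (K \<omega>) \<omega>"
    proof (intro AE_I2 tendsto_eventually)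
      show "\<forall>\<^sub>F n in sequentially. (if K \<omega> < n then h (K \<omega>) \<omega> else 0) = h (K \<omega>) \<omega>" for \<omega>
        using eventually_gt_at_top[of "K \<omega>"] by eventually_elim simp
    qed
    show "AE \<omega> in M. norm (if K \<omega> < n then h (K \<omega>) \<omega> else 0) \<le> C" for n
      using bound order_trans[OF norm_ge_zero bound] by auto
  qed auto
  then show ?thesis
    by (simp add: sums_def partial flip: Bochner_Integration.integral_sum[OF int])
qed

text \<open>\<open>nat \<lfloor>_\<rfloor>\<close> is measurable and undoes the coercion.\<close>

lemma measurable_indep_var_real:
  fixes K :: "'a \<Rightarrow> nat"
  assumes "indep_var borel (\<lambda>\<omega>. real (K \<omega>)) borel V"
  shows "K \<in> measurable M (count_space UNIV)"
proof -
  have [measurable]: "(\<lambda>\<omega>. real (K \<omega>)) \<in> borel_measurable M"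
    using assms by (rule indep_var_rv1)
  have "(\<lambda>\<omega>. nat \<lfloor>real (K \<omega>)\<rfloor>) \<in> measurable M (count_space UNIV)"
    by measurable
  then show ?thesis by simp
qed

text \<open>
  \<open>indep_var\<close> needs both variables to have the same type, hence the coercion of the index to \<open>real\<close>.
\<close>

lemma expectation_random_index:
  fixes K :: "'a \<Rightarrow> nat" and Z :: "nat \<Rightarrow> 'a \<Rightarrow> real" and f :: "real \<Rightarrow> complex"
  assumes indep: "\<And>k. indep_var borel (\<lambda>\<omega>. real (K \<omega>)) borel (Z k)"
    and f[measurable]: "f \<in> borel_measurable borel"
    and bound: "\<And>x. norm (f x) \<le> C"
  shows "expectation (\<lambda>\<omega>. f (Z (K \<omega>) \<omega>)) = expectation (\<lambda>\<omega>. expectation (\<lambda>\<omega>'. f (Z (K \<omega>) \<omega>')))"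
proof -
  have K[measurable]: "K \<in> measurable M (count_space UNIV)"
    using indep by (rule measurable_indep_var_real)
  have Z[measurable]: "Z k \<in> borel_measurable M" for k
    using indep by (rule indep_var_rv2)
  have int: "integrable M (\<lambda>\<omega>. f (Z k \<omega>))" for k
    by (intro integrable_const_bound[where B = C]) (auto simp: bound)
  have bound': "norm (expectation (\<lambda>\<omega>. f (Z k \<omega>))) \<le> C" for k
  proof -
    have "norm (expectation (\<lambda>\<omega>. f (Z k \<omega>))) \<le> expectation (\<lambda>\<omega>. norm (f (Z k \<omega>)))"
      by (rule integral_norm_bound)
    also have "\<dots> \<le> expectation (\<lambda>_. C)"
      using int by (intro integral_mono) (auto simp: bound)
    finally show ?thesis by (simp add: prob_space)
  qed
  have int1: "integrable M (\<lambda>\<omega>. indicator {k} (K \<omega>) :: complex)" for k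
    by (intro integrable_const_bound[where B = 1]) (auto simp: indicator_def)
  \<comment> \<open>Composing with \<open>indicator {real k}\<close> on the real line recovers the
    event \<open>K \<omega> = k\<close> from the coerced index, so independence factorises each
    term.\<close>
  have "expectation (\<lambda>\<omega>. indicator {k} (K \<omega>) * f (Z k \<omega>)) =
      expectation (\<lambda>\<omega>. indicator {k} (K \<omega>)) * expectation (\<lambda>\<omega>. f (Z k \<omega>))" for k
    using indep_var_compose[OF indep[of k], of "indicator {real k}" borel f borel]
    by (intro indep_var_lebesgue_integral int int1) (auto simp: comp_def indicator_def)
  also have "\<dots> k = expectation (\<lambda>\<omega>. indicator {k} (K \<omega>) * expectation (\<lambda>\<omega>'. f (Z k \<omega>')))" for k
    by simp
  \<comment> \<open>The same splitting, now with \<open>h k\<close> constant in \<omega>: both sides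
    of the claim are sums of one series.\<close>
  finally have "(\<lambda>k. expectation (\<lambda>\<omega>. indicator {k} (K \<omega>) * f (Z k \<omega>))) sums
      expectation (\<lambda>\<omega>. expectation (\<lambda>\<omega>'. f (Z (K \<omega>) \<omega>')))"
    using sums_expectation_random_index[OF K, of "\<lambda>k _. expectation (\<lambda>\<omega>'. f (Z k \<omega>'))" C] bound'
    by simp
  then show ?thesis
    using sums_expectation_random_index[OF K, of "\<lambda>k \<omega>. f (Z k \<omega>)" C] bound
    by (simp add: sums_unique2)
qed

section \<open>Independence of functionals of independent processes\<close>

text \<open>Packs \<open>process_events\<close> as a measure space, so that being a functional of
  the process becomes an ordinary measurability statement that \<open>measurable\<close> can
  prove.\<close>

definition process_algebra :: "'i set \<Rightarrow> ('i \<Rightarrow> 'a \<Rightarrow> 'b::topological_space) \<Rightarrow> 'a measure" where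
  "process_algebra T X = sigma (space M) {X t -` A \<inter> space M | t A. t \<in> T \<and> A \<in> sets borel}"

lemma space_process_algebra: "space (process_algebra T X) = space M"
  by (simp add: process_algebra_def space_measure_of_conv)

lemma sets_process_algebra: "sets (process_algebra T X) = process_events T X"
  unfolding process_algebra_def process_events_def by (intro sets_measure_of) auto

lemma measurable_process_algebra: "t \<in> T \<Longrightarrow> X t \<in> borel_measurable (process_algebra T X)"
  by (intro measurableI)
     (auto simp: space_process_algebra sets_process_algebra process_events_def intro!: sigma_sets.Basic)

lemma pullback_subset_process_events:
  assumes "W \<in> measurable (process_algebra T X) S"
  shows "sigma_sets (space M) {W -` A \<inter> space M | A. A \<in> sets S} \<subseteq> process_events T X"
  using sets.sigma_sets_subset[of "{W -` A \<inter> space M | A. A \<in> sets S}" "process_algebra T X"]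
    measurable_sets[OF assms]
  by (auto simp: space_process_algebra sets_process_algebra)

lemma random_variable_process_algebra:
  assumes "W \<in> measurable (process_algebra T X) S" "process_events T X \<subseteq> events"
  shows "random_variable S W"
  using measurable_space[OF assms(1)] measurable_sets[OF assms(1)] assms(2)
  by (intro measurableI) (auto simp: space_process_algebra sets_process_algebra)

text \<open>The \<sigma>-algebras generated by \<open>U\<close> and \<open>V\<close> lie inside the
  events of the two processes, and independence passes to smaller families.\<close>

lemma indep_var_process_algebra:
  assumes indep: "indep_set (process_events T X) (process_events T' X')"
    and U: "U \<in> measurable (process_algebra T X) S"
    and V: "V \<in> measurable (process_algebra T' X') S'"
  shows "indep_var S U S' V"
proof -
  have "process_events T X \<subseteq> events" "process_events T' X' \<subseteq> events"
    using indep by (auto simp: indep_sets2_eq)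
  then have "random_variable S U" "random_variable S' V"
    using random_variable_process_algebra U V by blast+
  moreover have "indep_set (sigma_sets (space M) {U -` A \<inter> space M | A. A \<in> sets S})
      (sigma_sets (space M) {V -` A \<inter> space M | A. A \<in> sets S'})"
    using indep pullback_subset_process_events[OF U] pullback_subset_process_events[OF V]
    unfolding indep_sets2_eq by blast
  ultimately show ?thesis
    unfolding indep_var_eq by blast
qed

end

section \<open>Characteristic function of the Poisson random sum\<close>

text \<open>The weighted powers of \<open>z\<close> form the exponential series of
  \<open>r * z\<close> times \<open>exp (- r)\<close>; absolute convergence of that series gives
  integrability for every complex \<open>z\<close>.\<close>

lemma expectation_poisson_power:
  fixes z :: complex
  assumes "r > 0"
  shows "measure_pmf.expectation (poisson_pmf r) (\<lambda>n. z ^ n) = exp (r * (z - 1))"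
proof -
  have eq: "pmf (poisson_pmf r) n *\<^sub>R z ^ n = exp (- of_real r) * ((of_real r * z) ^ n /\<^sub>R fact n)" for n
    using assms by (simp add: scaleR_conv_of_real power_mult_distrib divide_inverse exp_of_real[symmetric])
  have sums: "(\<lambda>n. pmf (poisson_pmf r) n *\<^sub>R z ^ n) sums (exp (- of_real r) * exp (of_real r * z))"
    unfolding eq by (intro sums_mult exp_converges)
  have "summable (\<lambda>n. norm (pmf (poisson_pmf r) n *\<^sub>R z ^ n))"
    unfolding eq norm_mult by (intro summable_mult summable_norm_exp)
  then have "integrable (count_space UNIV) (\<lambda>n. pmf (poisson_pmf r) n *\<^sub>R z ^ n)"
    by (simp only: integrable_count_space_nat_iff)
  then have "(\<integral>n. pmf (poisson_pmf r) n *\<^sub>R z ^ n \<partial>count_space UNIV) = exp (- of_real r) * exp (of_real r * z)"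
    unfolding sums_unique[OF sums] by (rule integral_count_space_nat)
  then show ?thesis
    by (simp add: measure_pmf_eq_density integral_density pmf_nonneg algebra_simps flip: exp_add)
qed

context prob_space
begin

text \<open>For a fixed upper limit \<open>n\<close> the sum has \<open>n + 1\<close> independent
  terms, hence characteristic function \<open>z ^ Suc n\<close>. Averaging over \<open>N r\<close>
  leaves one factor \<open>z\<close> outside the Poisson generating function.\<close>

lemma char_poisson_random_sum:
  fixes N :: "real \<Rightarrow> 'a \<Rightarrow> nat" and Y :: "nat \<Rightarrow> 'a \<Rightarrow> real"
  assumes N: "poisson_process 1 N"
    and Y: "indep_vars (\<lambda>_. borel) Y UNIV"
    and char_Y: "\<And>j. char (distr M borel (Y j)) u = z"
    and indep: "indep_set (process_events {0..} N) (process_events UNIV Y)"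
    and "r \<ge> 0"
  shows "(\<lambda>\<omega>. \<Sum>j=0..N r \<omega>. Y j \<omega>) \<in> borel_measurable M"
    and "char (distr M borel (\<lambda>\<omega>. \<Sum>j=0..N r \<omega>. Y j \<omega>)) u = z * exp (r * (z - 1))"
proof -
  let ?S = "\<lambda>n \<omega>. \<Sum>j=0..n. Y j \<omega>"
  have [measurable]: "Y j \<in> borel_measurable (process_algebra UNIV Y)" for j
    by (rule measurable_process_algebra) simp
  have "N r \<in> borel_measurable (process_algebra {0..} N)"
    using \<open>r \<ge> 0\<close> by (intro measurable_process_algebra) simp
  then have "(\<lambda>\<omega>. real (N r \<omega>)) \<in> borel_measurable (process_algebra {0..} N)"
    by (rule measurable_compose[OF _ borel_measurable_continuous_onI]) simp
  then have iv: "indep_var borel (\<lambda>\<omega>. real (N r \<omega>)) borel (?S n)" for n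
    by (rule indep_var_process_algebra[OF indep]) measurable
  note K[measurable] = measurable_indep_var_real[OF iv] and S[measurable] = indep_var_rv2[OF iv]
  show meas: "(\<lambda>\<omega>. ?S (N r \<omega>) \<omega>) \<in> borel_measurable M"
    by (rule measurable_compose_countable[OF S K])
  have char_S: "expectation (\<lambda>\<omega>. iexp (u * ?S n \<omega>)) = z ^ Suc n" for n
  proof -
    have "expectation (\<lambda>\<omega>. iexp (u * ?S n \<omega>)) = char (distr M borel (?S n)) u"
      unfolding char_def by (rule integral_distr[symmetric]) auto
    also have "\<dots> = z ^ Suc n"
      by (subst char_distr_sum[OF indep_vars_subset[OF Y]]) (auto simp: char_Y)
    finally show ?thesis .
  qed
  have "char (distr M borel (\<lambda>\<omega>. ?S (N r \<omega>) \<omega>)) u = expectation (\<lambda>\<omega>. iexp (u * ?S (N r \<omega>) \<omega>))"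
    using meas by (simp add: char_def integral_distr)
  also have "\<dots> = expectation (\<lambda>\<omega>. expectation (\<lambda>\<omega>'. iexp (u * ?S (N r \<omega>) \<omega>')))"
    by (rule expectation_random_index[OF iv, where C = 1]) auto
  also have "\<dots> = expectation (\<lambda>\<omega>. z * z ^ N r \<omega>)"
    unfolding char_S by simp
  also have "\<dots> = z * expectation (\<lambda>\<omega>. z ^ N r \<omega>)"
    by simp
  also have "expectation (\<lambda>\<omega>. z ^ N r \<omega>) = exp (r * (z - 1))"
  \<comment> \<open>\<open>poisson_process\<close> prescribes the Poisson law at positive times; at
    time 0 the process starts at 0.\<close>
  proof (cases "r = 0")
    case True
    then have "expectation (\<lambda>\<omega>. z ^ N r \<omega>) = expectation (\<lambda>\<omega>. 1)"
      using N by (intro Bochner_Integration.integral_cong)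
        (auto simp: poisson_process_def levy_process_def)
    then show ?thesis using True by (simp add: prob_space)
  next
    case False
    with \<open>r \<ge> 0\<close> have "r > 0" by simp
    have "expectation (\<lambda>\<omega>. z ^ N r \<omega>) = integral\<^sup>L (distr M (count_space UNIV) (N r)) (\<lambda>n. z ^ n)"
      by (subst integral_distr) auto
    also have "distr M (count_space UNIV) (N r) = measure_pmf (poisson_pmf r)"
      using N \<open>r > 0\<close> by (simp add: poisson_process_def)
    finally show ?thesis
      using expectation_poisson_power[OF \<open>r > 0\<close>] by simp
  qed
  finally show "char (distr M borel (\<lambda>\<omega>. ?S (N r \<omega>) \<omega>)) u = z * exp (r * (z - 1))" .
qed

section \<open>Characteristic functions of Brownian motion and of the Variance Gamma process\<close>

text \<open>Rescaling by the standard deviation \<open>sqrt (2 * t)\<close> reduces to the standard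
  normal law. Time 0 is separate: there the law is a point mass.\<close>

lemma char_brownian_motion:
  assumes B: "brownian_motion B" and "t \<ge> 0"
  shows "expectation (\<lambda>\<omega>. iexp (u * B t \<omega>)) = exp (- (u\<^sup>2) * t)"
proof (cases "t = 0")
  case True
  then have "expectation (\<lambda>\<omega>. iexp (u * B t \<omega>)) = expectation (\<lambda>\<omega>. 1)"
    using B by (intro Bochner_Integration.integral_cong)
      (auto simp: brownian_motion_def levy_process_def)
  then show ?thesis using True by (simp add: prob_space)
next
  case False
  with \<open>t \<ge> 0\<close> have "t > 0" by simp
  define \<sigma> where "\<sigma> = sqrt (2 * t)"
  have \<sigma>: "\<sigma> > 0" "\<sigma>\<^sup>2 = 2 * t"
    using \<open>t > 0\<close> by (auto simp: \<sigma>_def)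
  have "(\<lambda>x. ennreal (exp (- x\<^sup>2 / (4 * t)) / sqrt (4 * pi * t))) = (\<lambda>x. ennreal (normal_density 0 \<sigma> x))"
    by (simp add: normal_density_def \<sigma> mult_ac)
  then have "distributed M lborel (B t) (normal_density 0 \<sigma>)"
    using B \<open>t > 0\<close> unfolding brownian_motion_def by metis
  then have std: "distributed M lborel (\<lambda>\<omega>. B t \<omega> / \<sigma>) std_normal_density"
    using normal_standard_normal_convert[OF \<sigma>(1), of "B t" 0] by simp
  have [measurable]: "(\<lambda>\<omega>. B t \<omega> / \<sigma>) \<in> borel_measurable M"
    using distributed_measurable[OF std] by simp
  have "expectation (\<lambda>\<omega>. iexp (u * B t \<omega>)) = expectation (\<lambda>\<omega>. iexp ((u * \<sigma>) * (B t \<omega> / \<sigma>)))"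
    using \<sigma> by simp
  also have "\<dots> = char (distr M lborel (\<lambda>\<omega>. B t \<omega> / \<sigma>)) (u * \<sigma>)"
    unfolding char_def by (subst integral_distr) auto
  also have "\<dots> = exp (- ((u * \<sigma>)\<^sup>2) / 2)"
    unfolding distributed_distr_eq_density[OF std] char_std_normal_distribution ..
  also have "- ((u * \<sigma>)\<^sup>2) / 2 = - (u\<^sup>2) * t"
    by (simp add: power_mult_distrib \<sigma>)
  finally show ?thesis .
qed

lemma char_variance_gamma_process:
  assumes X: "variance_gamma_process a b X" and "s \<ge> 0"
  shows "X s \<in> borel_measurable M"
    and "char (distr M borel (X s)) u = exp (- s * a * ln (1 + u\<^sup>2 / b))"
proof -
  obtain H B where H: "gamma_subordinator a b H" and B: "brownian_motion B"
    and indep: "indep_set (process_events {0..} H) (process_events {0..} B)"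
    and X_eq: "\<And>t \<omega>. t \<ge> 0 \<Longrightarrow> \<omega> \<in> space M \<Longrightarrow> X t \<omega> = B (H t \<omega>) \<omega>"
    using X unfolding variance_gamma_process_def by blast
  have H_meas[measurable]: "H s \<in> borel_measurable M"
    using H \<open>s \<ge> 0\<close> by (auto simp: gamma_subordinator_def levy_process_def)
  have H_nonneg: "H s \<omega> \<ge> 0" if "\<omega> \<in> space M" for \<omega>
  proof -
    have "H 0 \<omega> = 0" "mono_on {0..} (\<lambda>t. H t \<omega>)"
      using H that by (auto simp: gamma_subordinator_def levy_process_def)
    then show ?thesis using mono_onD[of "{0..}" "\<lambda>t. H t \<omega>" 0 s] \<open>s \<ge> 0\<close> by simp
  qed
  \<comment> \<open>\<open>K n\<close> is the index of the grid point of mesh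
    \<open>1 / Suc n\<close> just below \<open>H s\<close>, and \<open>Z n k\<close> is the Brownian
    motion at grid point \<open>k\<close>; \<open>Suc n\<close> keeps the mesh finite at
    \<open>n = 0\<close>.\<close>
  define K where "K n \<omega> = nat \<lfloor>real (Suc n) * H s \<omega>\<rfloor>" for n \<omega>
  define Z where "Z n k = B (real k / real (Suc n))" for n k
  have "H s \<in> borel_measurable (process_algebra {0..} H)"
    using \<open>s \<ge> 0\<close> by (intro measurable_process_algebra) simp
  then have K: "(\<lambda>\<omega>. real (K n \<omega>)) \<in> borel_measurable (process_algebra {0..} H)" for n
    unfolding K_def by measurable
  have "Z n k \<in> borel_measurable (process_algebra {0..} B)" for n k
    unfolding Z_def by (intro measurable_process_algebra) simp
  then have iv: "indep_var borel (\<lambda>\<omega>. real (K n \<omega>)) borel (Z n k)" for n k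
    by (rule indep_var_process_algebra[OF indep K])
  note K_meas[measurable] = measurable_indep_var_real[OF iv] and Z_meas[measurable] = indep_var_rv2[OF iv]
  have ZK_meas[measurable]: "(\<lambda>\<omega>. Z n (K n \<omega>) \<omega>) \<in> borel_measurable M" for n
    by (rule measurable_compose_countable[OF Z_meas K_meas])
  have K_lim: "(\<lambda>n. real (K n \<omega>) / real (Suc n)) \<longlonglongrightarrow> H s \<omega>" if "\<omega> \<in> space M" for \<omega>
  proof (rule LIMSEQ_I, goal_cases)
    case (1 e)
    then obtain n0 where n0: "inverse (real (Suc n0)) < e"
      using reals_Archimedean by blast
    have "norm (real (K n \<omega>) / real (Suc n) - H s \<omega>) < e" if "n \<ge> n0" for n
    proof -
      let ?x = "real (Suc n) * H s \<omega>"
      have K_eq: "real (K n \<omega>) = of_int \<lfloor>?x\<rfloor>"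
        \<comment> \<open>Nonnegativity of \<open>H s\<close> ensures that \<open>nat\<close> does
          not truncate the floor.\<close>
        using H_nonneg[OF \<open>\<omega> \<in> space M\<close>] by (simp add: K_def)
      have "\<bar>real (K n \<omega>) - ?x\<bar> \<le> 1"
        unfolding K_eq by linarith
      then have "norm (real (K n \<omega>) / real (Suc n) - H s \<omega>) \<le> inverse (real (Suc n))"
        by (simp add: divide_simps abs_le_iff del: of_nat_Suc) (simp add: algebra_simps)
      also have "\<dots> \<le> inverse (real (Suc n0))"
        using that by (simp add: field_simps)
      finally show ?thesis using n0 by simp
    qed
    then show ?case by blast
  qed
  have Z_lim: "(\<lambda>n. Z n (K n \<omega>) \<omega>) \<longlonglongrightarrow> X s \<omega>" if "\<omega> \<in> space M" for \<omega>
  proof -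
    have "continuous_on {0..} (\<lambda>t. B t \<omega>)"
      using B that by (simp add: brownian_motion_def)
    from continuous_on_tendsto_compose[OF this K_lim[OF that]] show ?thesis
      using X_eq[OF \<open>s \<ge> 0\<close> that] H_nonneg[OF that] by (simp add: Z_def)
  qed
  \<comment> \<open>\<open>X s\<close> is the pointwise limit of the measurable grid
    approximations.\<close>
  show X_meas[measurable]: "X s \<in> borel_measurable M"
    by (rule borel_measurable_LIMSEQ_metric[OF ZK_meas Z_lim])
  let ?c = "\<lambda>x. complex_of_real (exp (- (u\<^sup>2) * x))"
  have "(\<lambda>n. expectation (\<lambda>\<omega>. iexp (u * Z n (K n \<omega>) \<omega>))) \<longlonglongrightarrow> expectation (\<lambda>\<omega>. iexp (u * X s \<omega>))"
    by (rule integral_dominated_convergence[where w = "\<lambda>_. 1"])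
       (auto intro!: tendsto_intros Z_lim)
  moreover have "expectation (\<lambda>\<omega>. iexp (u * Z n (K n \<omega>) \<omega>)) =
      expectation (\<lambda>\<omega>. ?c (real (K n \<omega>) / real (Suc n)))" for n
  proof -
    have "expectation (\<lambda>\<omega>. iexp (u * Z n (K n \<omega>) \<omega>)) =
        expectation (\<lambda>\<omega>. expectation (\<lambda>\<omega>'. iexp (u * Z n (K n \<omega>) \<omega>')))"
      by (rule expectation_random_index[OF iv, where C = 1]) auto
    moreover have "expectation (\<lambda>\<omega>'. iexp (u * Z n k \<omega>')) = ?c (real k / real (Suc n))" for k
      unfolding Z_def by (rule char_brownian_motion[OF B]) simp
    ultimately show ?thesis by (simp only:)
  qed
  moreover have "(\<lambda>n. expectation (\<lambda>\<omega>. ?c (real (K n \<omega>) / real (Suc n)))) \<longlonglongrightarrow>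
      expectation (\<lambda>\<omega>. ?c (H s \<omega>))"
  proof (rule integral_dominated_convergence[where w = "\<lambda>_. 1"])
    show "AE \<omega> in M. (\<lambda>n. ?c (real (K n \<omega>) / real (Suc n))) \<longlonglongrightarrow> ?c (H s \<omega>)"
      by (intro AE_I2 tendsto_intros K_lim)
    show "AE \<omega> in M. norm (?c (real (K n \<omega>) / real (Suc n))) \<le> 1" for n
      by (intro AE_I2) simp
  qed auto
  ultimately have "expectation (\<lambda>\<omega>. iexp (u * X s \<omega>)) = expectation (\<lambda>\<omega>. ?c (H s \<omega>))"
    by (simp add: LIMSEQ_unique)
  also have "\<dots> = expectation (\<lambda>\<omega>. exp (- (u\<^sup>2) * H s \<omega>))"
    by (rule integral_complex_of_real)
  also have "expectation (\<lambda>\<omega>. exp (- (u\<^sup>2) * H s \<omega>)) = exp (- s * a * ln (1 + u\<^sup>2 / b))"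
  \<comment> \<open>The Laplace transform of \<open>H s\<close> is taken at
    \<open>u\<^sup>2\<close>, and \<open>gamma_subordinator\<close> gives it at positive
    arguments.\<close>
  proof (cases "u = 0")
    case False
    then show ?thesis
      using H \<open>s \<ge> 0\<close> by (simp add: gamma_subordinator_def)
  qed (simp add: prob_space)
  finally show "char (distr M borel (X s)) u = exp (- s * a * ln (1 + u\<^sup>2 / b))"
    by (simp add: char_def integral_distr)
qed

end

section \<open>The Frullani integral\<close>

lemma set_integrable_exp_Ioi: "c > 0 \<Longrightarrow> set_integrable lborel {0<..} (\<lambda>y::real. exp (- c * y))"
  using integrable_I0i_exp_mscale[of c] by (simp add: mult.commute)

lemma LBINT_exp_sin:
  fixes c v :: real
  assumes "c > 0"
  shows "(LBINT y:{0<..}. exp (- c * y) * sin (v * y)) = v / (c\<^sup>2 + v\<^sup>2)"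
proof -
  \<comment> \<open>The imaginary part of \<open>exp ((- c + i v) y) / (- c + i v)\<close>, an
    antiderivative of the integrand.\<close>
  let ?F = "\<lambda>y. - exp (- c * y) * (c * sin (v * y) + v * cos (v * y)) / (c\<^sup>2 + v\<^sup>2)"
  have pos: "c\<^sup>2 + v\<^sup>2 > 0"
    using assms by (simp add: add_pos_nonneg)
  have "(LBINT y=0..\<infinity>. exp (- c * y) * sin (v * y)) = 0 - (- v / (c\<^sup>2 + v\<^sup>2))"
  proof (rule interval_integral_FTC_integrable[where F = ?F])
    show "(?F has_vector_derivative exp (- c * y) * sin (v * y)) (at y)" for y
      unfolding has_real_derivative_iff_has_vector_derivative[symmetric]
      using pos by (auto intro!: derivative_eq_intros simp: divide_simps)
        (simp_all add: algebra_simps power2_eq_square)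
    show "isCont (\<lambda>y. exp (- c * y) * sin (v * y)) y" for y
      by (intro continuous_intros)
    have "set_integrable lborel {0<..} (\<lambda>y. exp (- c * y) * sin (v * y))"
      by (rule set_integrable_bound[OF set_integrable_exp_Ioi[OF assms]])
         (auto simp: abs_mult set_borel_measurable_def mult_left_le)
    then show "set_integrable lborel (einterval 0 \<infinity>) (\<lambda>y. exp (- c * y) * sin (v * y))"
      unfolding zero_ereal_def by simp
    show "((?F \<circ> real_of_ereal) \<longlongrightarrow> - v / (c\<^sup>2 + v\<^sup>2)) (at_right 0)"
      unfolding zero_ereal_def ereal_tendsto_simps
      using pos by (auto intro!: tendsto_eq_intros)
    have "(?F \<longlongrightarrow> 0) at_top"
    proof (rule tendsto_rabs_zero_cancel, rule tendsto_sandwich)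
      show "((\<lambda>_. 0::real) \<longlongrightarrow> 0) at_top" by simp
      have "filterlim (\<lambda>y. - c * y) at_bot at_top"
        using filterlim_tendsto_pos_mult_at_top[OF tendsto_const assms filterlim_ident]
        by (simp add: filterlim_uminus_at_bot)
      then have "((\<lambda>y. exp (- c * y)) \<longlongrightarrow> 0) at_top"
        by (rule filterlim_compose[OF exp_at_bot])
      then show "((\<lambda>y. exp (- c * y) * ((\<bar>c\<bar> + \<bar>v\<bar>) / (c\<^sup>2 + v\<^sup>2))) \<longlongrightarrow> 0) at_top"
        by (rule tendsto_mult_left_zero)
      have "\<bar>c * sin (v * y) + v * cos (v * y)\<bar> \<le> \<bar>c\<bar> + \<bar>v\<bar>" for y
        by (intro order_trans[OF abs_triangle_ineq] add_mono) (auto simp: abs_mult mult_left_le)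
      then show "\<forall>\<^sub>F y in at_top. \<bar>?F y\<bar> \<le> exp (- c * y) * ((\<bar>c\<bar> + \<bar>v\<bar>) / (c\<^sup>2 + v\<^sup>2))"
        using pos by (auto simp: abs_mult divide_simps)
    qed simp
    then show "((?F \<circ> real_of_ereal) \<longlongrightarrow> 0) (at_left \<infinity>)"
      unfolding ereal_tendsto_simps .
  qed simp
  then show ?thesis
    by (simp add: interval_lebesgue_integral_0_infty)
qed

text \<open>
  Frullani: write \<open>(cos (u y) - 1) / y\<close> as minus the integral of \<open>sin (v y)\<close> over \<open>v\<close> from \<open>0\<close>
  to \<open>u\<close> and exchange the integrals.
\<close>

lemma LBINT_frullani_cos:
  fixes c u :: real
  assumes "c > 0"
  shows "(LBINT y:{0<..}. exp (- c * y) / y * (cos (u * y) - 1)) = - ln (1 + u\<^sup>2 / c\<^sup>2) / 2"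
proof -
  \<comment> \<open>The sign restriction makes \<open>{0..u}\<close> the range of \<open>v\<close>;
    the general case follows because both sides are even in \<open>u\<close>.\<close>
  have *: "(LBINT y:{0<..}. exp (- c * y) / y * (cos (u * y) - 1)) = - ln (1 + u\<^sup>2 / c\<^sup>2) / 2"
    if "u \<ge> 0" for u
  proof -
    let ?f = "\<lambda>v y. indicator {0<..} y *\<^sub>R (indicator {0..u} v *\<^sub>R (exp (- c * y) * sin (v * y)))"
    have sin: "(\<integral>v. ?f v y \<partial>lborel) = - (indicator {0<..} y *\<^sub>R (exp (- c * y) / y * (cos (u * y) - 1)))" for y
    proof (cases "y > 0")
      case True
      have "(\<integral>v. indicator {0..u} v *\<^sub>R (exp (- c * y) * sin (v * y)) \<partial>lborel) =
          (- exp (- c * y) / y * cos (u * y)) - (- exp (- c * y) / y * cos (0 * y))"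
        using that True
        by (intro integral_FTC_atLeastAtMost)
           (auto intro!: derivative_eq_intros continuous_intros
              simp flip: has_real_derivative_iff_has_vector_derivative)
      then show ?thesis using True by (simp add: algebra_simps diff_divide_distrib)
    qed simp
    \<comment> \<open>As the sine is bounded by 1, this product dominates \<open>?f\<close> and
      justifies the exchange of integrals.\<close>
    have "integrable (lborel \<Otimes>\<^sub>M lborel) (\<lambda>(v, y). indicator {0..u} v * (indicator {0<..} y *\<^sub>R exp (- c * y)))"
      using set_integrable_exp_Ioi[OF assms] integrable_real_indicator[of "{0..u}" lborel]
      by (intro lborel_pair.Fubini_integrable) (auto simp: set_integrable_def abs_mult that)
    then have int: "integrable (lborel \<Otimes>\<^sub>M lborel) (\<lambda>(v, y). ?f v y)"
      by (rule Bochner_Integration.integrable_bound)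
         (auto simp: abs_mult mult_left_le indicator_def split: prod.split)
    have "- (LBINT y:{0<..}. exp (- c * y) / y * (cos (u * y) - 1)) = (\<integral>y. \<integral>v. ?f v y \<partial>lborel \<partial>lborel)"
      unfolding sin set_lebesgue_integral_def by simp
    also have "\<dots> = (\<integral>v. \<integral>y. ?f v y \<partial>lborel \<partial>lborel)"
      using int by (rule lborel_pair.Fubini_integral)
    also have "\<dots> = (\<integral>v. indicator {0..u} v *\<^sub>R (v / (c\<^sup>2 + v\<^sup>2)) \<partial>lborel)"
    proof (intro Bochner_Integration.integral_cong refl)
      fix v
      have "(\<integral>y. ?f v y \<partial>lborel) = indicator {0..u} v *\<^sub>R (LBINT y:{0<..}. exp (- c * y) * sin (v * y))"
        unfolding set_lebesgue_integral_def by (simp add: indicator_def)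
      then show "(\<integral>y. ?f v y \<partial>lborel) = indicator {0..u} v *\<^sub>R (v / (c\<^sup>2 + v\<^sup>2))"
        unfolding LBINT_exp_sin[OF assms] .
    qed
    also have "\<dots> = ln (c\<^sup>2 + u\<^sup>2) / 2 - ln (c\<^sup>2 + 0\<^sup>2) / 2"
    proof (intro integral_FTC_atLeastAtMost)
      have pos: "c\<^sup>2 + v\<^sup>2 > 0" for v
        using assms by (simp add: add_pos_nonneg)
      show "((\<lambda>v. ln (c\<^sup>2 + v\<^sup>2) / 2) has_vector_derivative v / (c\<^sup>2 + v\<^sup>2)) (at v within {0..u})" for v
      proof -
        have "((\<lambda>v. c\<^sup>2 + v\<^sup>2) has_real_derivative 2 * v) (at v within {0..u})"
          by (auto intro!: derivative_eq_intros)
        from DERIV_cdivide[OF DERIV_chain2[where f = ln, OF DERIV_ln_divide[OF pos] this], of 2]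
        have "((\<lambda>v. ln (c\<^sup>2 + v\<^sup>2) / 2) has_real_derivative 1 / (c\<^sup>2 + v\<^sup>2) * (2 * v) / 2) (at v within {0..u})" .
        moreover have "1 / p * (2 * v) / 2 = v / p" for p
          by simp
        ultimately show ?thesis
          by (simp only: has_real_derivative_iff_has_vector_derivative)
      qed
      show "continuous_on {0..u} (\<lambda>v. v / (c\<^sup>2 + v\<^sup>2))"
        by (intro continuous_intros ballI pos[THEN less_imp_neq, THEN not_sym])
    qed (use that in auto)
    also have "\<dots> = ln ((c\<^sup>2 + u\<^sup>2) / c\<^sup>2) / 2"
      using assms by (subst ln_div) (auto simp: add_pos_nonneg diff_divide_distrib)
    also have "(c\<^sup>2 + u\<^sup>2) / c\<^sup>2 = 1 + u\<^sup>2 / c\<^sup>2"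
      using assms by (simp add: field_simps)
    finally show ?thesis by simp
  qed
  show ?thesis
    using *[of u] *[of "- u"] by (cases "u \<ge> 0") auto
qed

section \<open>Scaling, positivity and divergence of the exponential integral\<close>

lemma set_integrable_exp_div:
  fixes c g :: real
  assumes "c > 0" "g > 0"
  shows "set_integrable lborel {g<..} (\<lambda>y. exp (- c * y) / y)"
proof -
  have "set_integrable lborel {g<..} (\<lambda>y. exp (- c * y) / g)"
    using assms by (intro set_integrable_divide set_integrable_subset[OF set_integrable_exp_Ioi[OF assms(1)]]) auto
  then show ?thesis
    by (rule set_integrable_bound) (use assms in \<open>auto simp: set_borel_measurable_def frac_le\<close>)
qed

text \<open>The substitution \<open>z = c * y\<close> leaves \<open>dz / z\<close> invariant. It
  identifies the normalising constant in \<open>nu_Y\<close> as the integral of the unnormalised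
  density.\<close>

lemma E1_scale:
  fixes c g :: real
  assumes "c > 0"
  shows "E1 (c * g) = (LBINT y:{g<..}. exp (- c * y) / y)"
proof -
  have "E1 (c * g) = (\<integral>z. indicator {c * g<..} z *\<^sub>R (exp (- z) / z) \<partial>lborel)"
    by (simp add: E1_def interval_integral_to_infinity_eq set_lebesgue_integral_def)
  also have "\<dots> = \<bar>c\<bar> *\<^sub>R (\<integral>y. indicator {c * g<..} (0 + c * y) *\<^sub>R (exp (- (0 + c * y)) / (0 + c * y)) \<partial>lborel)"
    using assms by (intro lborel_integral_real_affine) simp
  also have "\<dots> = (\<integral>y. c * (indicator {c * g<..} (c * y) * (exp (- (c * y)) / (c * y))) \<partial>lborel)"
    using assms by (subst integral_mult_right_zero) simp
  also have "\<dots> = (\<integral>y. indicator {g<..} y *\<^sub>R (exp (- c * y) / y) \<partial>lborel)"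
    using assms by (intro Bochner_Integration.integral_cong refl) (simp add: indicator_def)
  finally show ?thesis by (simp add: set_lebesgue_integral_def)
qed

text \<open>On \<open>{x..1}\<close> the factor \<open>exp (- z)\<close> is at least
  \<open>exp (- 1)\<close>, and the integral of \<open>1 / z\<close> there is
  \<open>- ln x\<close>.\<close>

lemma E1_ge:
  fixes x :: real
  assumes "0 < x" "x \<le> 1"
  shows "exp (- 1) * (- ln x) \<le> E1 x"
proof -
  have cont: "continuous_on {x..1} (\<lambda>y. exp (- 1) / y)"
    using assms by (intro continuous_intros) auto
  have "exp (- 1) * (- ln x) = exp (- 1) * ln 1 - exp (- 1) * ln x"
    by simp
  also have "\<dots> = (\<integral>y. indicator {x..1} y *\<^sub>R (exp (- 1) / y) \<partial>lborel)"
    using assms cont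
    by (intro integral_FTC_atLeastAtMost[symmetric])
       (auto intro!: derivative_eq_intros simp flip: has_real_derivative_iff_has_vector_derivative)
  also have "\<dots> \<le> (\<integral>y. indicator {x<..} y *\<^sub>R (exp (- 1 * y) / y) \<partial>lborel)"
  proof (rule integral_mono_AE)
    show "integrable lborel (\<lambda>y. indicator {x..1} y *\<^sub>R (exp (- 1) / y))"
      using borel_integrable_atLeastAtMost'[OF cont] by (simp add: set_integrable_def)
    show "integrable lborel (\<lambda>y. indicator {x<..} y *\<^sub>R (exp (- 1 * y) / y))"
      using set_integrable_exp_div[of 1 x] assms by (simp add: set_integrable_def)
    \<comment> \<open>The comparison fails at the endpoint \<open>x\<close>, which is a null
      set.\<close>
    show "AE y in lborel. indicator {x..1} y *\<^sub>R (exp (- 1) / y) \<le> indicator {x<..} y *\<^sub>R (exp (- 1 * y) / y)"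
      using AE_lborel_singleton[of x] by eventually_elim
        (use assms in \<open>auto simp: indicator_def intro!: divide_right_mono\<close>)
  qed
  also have "\<dots> = E1 x"
    using E1_scale[of 1 x] by (simp add: set_lebesgue_integral_def)
  finally show ?thesis .
qed

lemma filterlim_E1_at_right_0: "filterlim E1 at_top (at_right 0)"
proof (rule filterlim_at_top_mono)
  have "filterlim (\<lambda>x::real. - ln x) at_top (at_right 0)"
    using ln_at_0 by (simp add: filterlim_uminus_at_top)
  then show "filterlim (\<lambda>x::real. exp (- 1) * (- ln x)) at_top (at_right 0)"
    by (intro filterlim_tendsto_pos_mult_at_top[OF tendsto_const]) simp_all
  show "\<forall>\<^sub>F x in at_right 0. exp (- 1) * (- ln x) \<le> E1 x"
    using eventually_at_right_real[of 0 "1::real"]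
    by (auto elim!: eventually_mono intro!: E1_ge[simplified])
qed

text \<open>The integrand is positive on \<open>{x<..<x+1}\<close>; a vanishing integral would make
  this interval of length 1 a null set.\<close>

lemma E1_pos:
  assumes "x > 0"
  shows "E1 x > 0"
proof -
  have int: "integrable lborel (\<lambda>y. indicator {x<..} y *\<^sub>R (exp (- 1 * y) / y))"
    using set_integrable_exp_div[of 1 x] assms by (simp add: set_integrable_def)
  have E1: "E1 x = (\<integral>y. indicator {x<..} y *\<^sub>R (exp (- 1 * y) / y) \<partial>lborel)"
    using E1_scale[of 1 x] by (simp add: set_lebesgue_integral_def)
  have "E1 x \<ge> 0"
    unfolding E1 using assms by (intro integral_nonneg_AE) (auto simp: indicator_def)
  moreover have "E1 x \<noteq> 0"
  proof
    assume "E1 x = 0"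
    then have "AE y in lborel. indicator {x<..} y *\<^sub>R (exp (- 1 * y) / y) = 0"
      unfolding E1 using int assms
      by (subst (asm) integral_nonneg_eq_0_iff_AE) (auto simp: indicator_def)
    then have "AE y in lborel. y \<notin> {x<..<x+1}"
      by eventually_elim (use assms in \<open>auto simp: indicator_def split: if_splits\<close>)
    then have "emeasure lborel {x<..<x+1} = 0"
      by (subst AE_iff_measurable[symmetric, of _ _ "\<lambda>y. y \<notin> {x<..<x+1}"]) auto
    then show False by simp
  qed
  ultimately show ?thesis by simp
qed

section \<open>The truncated integral and the law of the summands\<close>

text \<open>The bound \<bar>cos (u y) - 1\<bar> \<le> \<bar>u y\<bar> cancels the singularity
  \<open>1 / y\<close> and leaves the integrable majorant \<bar>u\<bar>
  \<open>exp (- c * y)\<close>, uniform in the cutoff.\<close>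

lemma tendsto_truncated_frullani_cos:
  fixes c u :: real
  assumes "c > 0" and g: "\<And>n. g n > 0" "g \<longlonglongrightarrow> 0"
  shows "(\<lambda>n. LBINT y:{g n<..}. exp (- c * y) / y * (cos (u * y) - 1)) \<longlonglongrightarrow> - ln (1 + u\<^sup>2 / c\<^sup>2) / 2"
  unfolding LBINT_frullani_cos[OF assms(1), symmetric] set_lebesgue_integral_def
proof (rule integral_dominated_convergence)
  show "integrable lborel (\<lambda>y. \<bar>u\<bar> * (indicator {0<..} y *\<^sub>R exp (- c * y)))"
    using set_integrable_exp_Ioi[OF assms(1)] by (simp add: set_integrable_def)
  show "AE y in lborel. norm (indicator {g n<..} y *\<^sub>R (exp (- c * y) / y * (cos (u * y) - 1)))
      \<le> \<bar>u\<bar> * (indicator {0<..} y *\<^sub>R exp (- c * y))" for n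
  proof (rule AE_I2)
    fix y :: real
    have "\<bar>cos (u * y) - 1\<bar> \<le> \<bar>u * y\<bar>"
    proof -
      \<comment> \<open>One sine factor is then bounded by its argument, the other by 1.\<close>
      have "\<bar>cos (u * y) - 1\<bar> = 2 * (\<bar>sin (u * y / 2)\<bar> * \<bar>sin (u * y / 2)\<bar>)"
        using cos_double_sin[of "u * y / 2"] by (simp add: power2_eq_square)
      also have "\<dots> \<le> 2 * (\<bar>u * y / 2\<bar> * 1)"
        by (intro mult_left_mono mult_mono abs_sin_x_le_abs_x) auto
      finally show ?thesis by simp
    qed
    then show "norm (indicator {g n<..} y *\<^sub>R (exp (- c * y) / y * (cos (u * y) - 1)))
      \<le> \<bar>u\<bar> * (indicator {0<..} y *\<^sub>R exp (- c * y))"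
      using g(1)[of n] mult_left_mono[of "\<bar>cos (u * y) - 1\<bar>" "\<bar>u * y\<bar>" "exp (- c * y) / y"]
      by (cases "y > g n") (simp_all add: indicator_def abs_mult mult.commute)
  qed
  show "AE y in lborel. (\<lambda>n. indicator {g n<..} y *\<^sub>R (exp (- c * y) / y * (cos (u * y) - 1)))
      \<longlonglongrightarrow> indicator {0<..} y *\<^sub>R (exp (- c * y) / y * (cos (u * y) - 1))"
  proof (rule AE_I2)
    fix y :: real
    have "\<forall>\<^sub>F n in sequentially. indicator {g n<..} y = (indicator {0<..} y :: real)"
    proof (cases "y > 0")
      case True
      then have "\<forall>\<^sub>F n in sequentially. g n < y"
        using order_tendstoD(2)[OF g(2)] by blast
      then show ?thesis
        by eventually_elim (use True in \<open>simp add: indicator_def\<close>)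
    next
      case False
      then have "\<not> g n < y" for n using g(1)[of n] by linarith
      then show ?thesis using False by (simp add: indicator_def)
    qed
    then show "(\<lambda>n. indicator {g n<..} y *\<^sub>R (exp (- c * y) / y * (cos (u * y) - 1)))
      \<longlonglongrightarrow> indicator {0<..} y *\<^sub>R (exp (- c * y) / y * (cos (u * y) - 1))"
      by (intro tendsto_eventually) (auto elim: eventually_mono)
  qed
qed auto

text \<open>The normalisation makes the factor \<open>E1 (sqrt b * \<gamma>)\<close> cancel the one in the Poisson intensity.\<close>

lemma char_nu_Y_star:
  assumes M: "prob_space M" and "b > 0" "\<gamma> > 0"
    and Y: "distributed M lborel Y (\<lambda>y. ennreal (nu_Y_star b \<gamma> y))"
  shows "char (distr M borel Y) u =
    1 + of_real ((LBINT y:{\<gamma><..}. exp (- sqrt b * y) / y * (cos (u * y) - 1)) / E1 (sqrt b * \<gamma>))"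
proof -
  interpret prob_space M by fact
  define c where "c = sqrt b"
  define E where "E = E1 (c * \<gamma>)"
  have c: "c > 0" using \<open>b > 0\<close> by (simp add: c_def)
  have E: "E > 0" using c \<open>\<gamma> > 0\<close> by (simp add: E_def E1_pos)
  let ?k = "\<lambda>y. indicator {\<gamma><..} y *\<^sub>R (exp (- c * y) / y)"
  have nu[measurable]: "nu_Y b \<gamma> \<in> borel_measurable borel"
    unfolding nu_Y_def by measurable
  have nu_nonneg: "nu_Y b \<gamma> y \<ge> 0" for y
    using \<open>\<gamma> > 0\<close> E by (auto simp: nu_Y_def indicator_def E_def c_def)
  \<comment> \<open>\<open>nu_Y\<close> lives on the closed half-line and \<open>?k\<close> on the
    open one; they differ only at \<gamma>.\<close>
  have nu_AE: "AE y in lborel. nu_Y b \<gamma> y = ?k y / E"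
    using AE_lborel_singleton[of \<gamma>] by eventually_elim (auto simp: nu_Y_def indicator_def E_def c_def)
  have int_k: "integrable lborel ?k"
    using set_integrable_exp_div[OF c \<open>\<gamma> > 0\<close>] by (simp add: set_integrable_def)
  have int_nu: "integrable lborel (nu_Y b \<gamma>)"
    using integrable_divide_zero[OF int_k, of E] nu_AE
    by (rule_tac integrable_cong_AE_imp) (auto elim!: eventually_mono)
  have int_nu_iexp: "integrable lborel (\<lambda>y. nu_Y b \<gamma> y *\<^sub>R iexp (v * y))" for v
    by (rule Bochner_Integration.integrable_bound[OF int_nu]) auto
  have int_nu_iexp': "integrable lborel (\<lambda>y. nu_Y b \<gamma> (- y) *\<^sub>R iexp (v * y))" for v
    using lborel_integrable_real_affine[OF int_nu_iexp[of "- v"], of "- 1" 0] by simp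
  have reflect: "(\<integral>y. nu_Y b \<gamma> (- y) *\<^sub>R iexp (u * y) \<partial>lborel) = (\<integral>y. nu_Y b \<gamma> y *\<^sub>R iexp (- u * y) \<partial>lborel)"
    by (subst lborel_integral_real_affine[of "- 1" _ 0]) auto
  have [measurable]: "Y \<in> borel_measurable M"
    using distributed_measurable[OF Y] by simp
  have "char (distr M borel Y) u = integral\<^sup>L (distr M lborel Y) (\<lambda>y. iexp (u * y))"
    unfolding char_def by (simp add: integral_distr)
  also have "\<dots> = (\<integral>y. nu_Y_star b \<gamma> y *\<^sub>R iexp (u * y) \<partial>lborel)"
    unfolding distributed_distr_eq_density[OF Y]
    by (rule integral_density) (auto simp: nu_Y_star_def nu_nonneg)
  also have "\<dots> = (\<integral>y. (1/2) *\<^sub>R (nu_Y b \<gamma> (- y) *\<^sub>R iexp (u * y)) + (1/2) *\<^sub>R (nu_Y b \<gamma> y *\<^sub>R iexp (u * y)) \<partial>lborel)"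
    by (simp add: nu_Y_star_def scaleR_add_left)
  also have "\<dots> = (1/2) *\<^sub>R (\<integral>y. nu_Y b \<gamma> y *\<^sub>R iexp (- u * y) \<partial>lborel) + (1/2) *\<^sub>R (\<integral>y. nu_Y b \<gamma> y *\<^sub>R iexp (u * y) \<partial>lborel)"
    using int_nu_iexp int_nu_iexp'
    by (simp only: Bochner_Integration.integral_add integrable_scaleR_right integral_scaleR_right reflect)
  \<comment> \<open>After reflection both halves carry the same density, so the two exponentials
    average to a cosine.\<close>
  also have "\<dots> = (\<integral>y. (1/2) *\<^sub>R (nu_Y b \<gamma> y *\<^sub>R iexp (- u * y)) + (1/2) *\<^sub>R (nu_Y b \<gamma> y *\<^sub>R iexp (u * y)) \<partial>lborel)"
    using int_nu_iexp
    by (simp only: Bochner_Integration.integral_add integrable_scaleR_right integral_scaleR_right)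
  also have "\<dots> = (\<integral>y. complex_of_real (nu_Y b \<gamma> y * cos (u * y)) \<partial>lborel)"
    by (intro Bochner_Integration.integral_cong refl) (simp add: complex_eq_iff Re_exp Im_exp)
  also have "\<dots> = of_real (\<integral>y. nu_Y b \<gamma> y * cos (u * y) \<partial>lborel)"
    by (rule integral_complex_of_real)
  \<comment> \<open>Writing the cosine as \<open>(cos (u * y) - 1) + 1\<close> isolates the total
    mass \<open>E / E = 1\<close>.\<close>
  also have "(\<integral>y. nu_Y b \<gamma> y * cos (u * y) \<partial>lborel) = (\<integral>y. (?k y * (cos (u * y) - 1) + ?k y) / E \<partial>lborel)"
    using nu_AE by (intro integral_cong_AE) (auto elim!: eventually_mono simp: field_simps add_divide_distrib diff_divide_distrib)
  also have "\<dots> = ((\<integral>y. ?k y * (cos (u * y) - 1) \<partial>lborel) + (\<integral>y. ?k y \<partial>lborel)) / E"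
  proof -
    have "integrable lborel (\<lambda>y. ?k y * (cos (u * y) - 1))"
    proof (rule Bochner_Integration.integrable_bound)
      show "integrable lborel (\<lambda>y. ?k y * 2)" using int_k by (rule integrable_mult_left)
      have "\<bar>cos (u * y) - 1\<bar> \<le> 2" for y
        using cos_le_one[of "u * y"] cos_ge_minus_one[of "u * y"] by linarith
      then show "AE y in lborel. norm (?k y * (cos (u * y) - 1)) \<le> norm (?k y * 2)"
        unfolding norm_mult by (intro AE_I2 mult_left_mono) auto
    qed auto
    then show ?thesis
      using int_k by (simp only: integral_divide_zero Bochner_Integration.integral_add)
  qed
  also have "(\<integral>y. ?k y \<partial>lborel) = E"
    unfolding E_def using E1_scale[OF c, of \<gamma>] by (simp add: set_lebesgue_integral_def)
  also have "(\<integral>y. ?k y * (cos (u * y) - 1) \<partial>lborel) = (LBINT y:{\<gamma><..}. exp (- c * y) / y * (cos (u * y) - 1))"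
    by (simp add: set_lebesgue_integral_def mult.assoc)
  finally show ?thesis
    using E by (simp add: add_divide_distrib E_def c_def)
qed

section \<open>Convergence in law\<close>

theorem corollary3p3:
  fixes a b :: real
    and M :: "'a measure" and N :: "real \<Rightarrow> 'a \<Rightarrow> nat" and Y :: "real \<Rightarrow> nat \<Rightarrow> 'a \<Rightarrow> real"
    and M' :: "'b measure" and X :: "real \<Rightarrow> 'b \<Rightarrow> real"
  assumes "a > 0" and "b > 0"
    and "prob_space M"
    and "prob_space.poisson_process M 1 N"
    and "\<And>\<gamma>. \<gamma> > 0 \<Longrightarrow> prob_space.indep_vars M (\<lambda>_. borel) (Y \<gamma>) UNIV"
    and "\<And>\<gamma> j. \<gamma> > 0 \<Longrightarrow> distributed M lborel (Y \<gamma> j) (\<lambda>y. ennreal (nu_Y_star b \<gamma> y))"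
    and "\<And>\<gamma>. \<gamma> > 0 \<Longrightarrow> prob_space.indep_set M
           (prob_space.process_events M {0..} N) (prob_space.process_events M UNIV (Y \<gamma>))"
    and "prob_space M'"
    and "prob_space.variance_gamma_process M' a b X"
  shows "\<forall>t\<ge>0. weak_conv_filter
           (\<lambda>\<gamma>. distr M borel (\<lambda>\<omega>. \<Sum>j=0..N (t * a * E1 (sqrt b * \<gamma>)) \<omega>. Y \<gamma> j \<omega>))
           (distr M' borel (X (t / 2)))
           (at_right 0)"
proof (intro allI impI)
  fix t :: real
  assume "t \<ge> 0"
  interpret M: prob_space M by fact
  interpret M': prob_space M' by fact
  define c where "c = sqrt b"
  have c: "c > 0" "c\<^sup>2 = b"
    using \<open>b > 0\<close> by (auto simp: c_def)
  define S where "S \<gamma> \<omega> = (\<Sum>j=0..N (t * a * E1 (c * \<gamma>)) \<omega>. Y \<gamma> j \<omega>)" for \<gamma> \<omega>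
  define I where "I u \<gamma> = (LBINT y:{\<gamma><..}. exp (- c * y) / y * (cos (u * y) - 1))" for u \<gamma>
  have S_meas: "S \<gamma> \<in> borel_measurable M"
    and char_S: "char (distr M borel (S \<gamma>)) u =
      (1 + of_real (I u \<gamma> / E1 (c * \<gamma>))) * exp (of_real (t * a * I u \<gamma>))"
    if "\<gamma> > 0" for \<gamma> u
  proof -
    have E: "E1 (c * \<gamma>) > 0"
      using c that by (simp add: E1_pos)
    have char_Y: "char (distr M borel (Y \<gamma> j)) u = 1 + of_real (I u \<gamma> / E1 (c * \<gamma>))" for u j
      unfolding I_def c_def by (rule char_nu_Y_star[OF \<open>prob_space M\<close> \<open>b > 0\<close> that assms(6)[OF that]])
    have rate: "t * a * E1 (c * \<gamma>) \<ge> 0"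
      using \<open>t \<ge> 0\<close> \<open>a > 0\<close> E by simp
    note sum = M.char_poisson_random_sum[OF assms(4) assms(5)[OF that] char_Y assms(7)[OF that] rate, folded S_def]
    show "S \<gamma> \<in> borel_measurable M"
      using sum(1) .
    show "char (distr M borel (S \<gamma>)) u =
        (1 + of_real (I u \<gamma> / E1 (c * \<gamma>))) * exp (of_real (t * a * I u \<gamma>))"
      using sum(2)[of u] E by (simp add: mult.assoc)
  qed
  note X_meas = M'.char_variance_gamma_process(1)[OF assms(9), of "t / 2"]
    and char_X = M'.char_variance_gamma_process(2)[OF assms(9), of "t / 2"]
  \<comment> \<open>The limit along \<open>at_right 0\<close> is tested on arbitrary positive null
    sequences \<open>g\<close>, to which \<open>levy_continuity\<close> applies.\<close>
  have conv: "weak_conv_m (\<lambda>n. distr M borel (S (g n))) (distr M' borel (X (t / 2)))"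
    if g: "\<And>n. g n > 0" "g \<longlonglongrightarrow> 0" for g :: "nat \<Rightarrow> real"
  proof (rule levy_continuity)
    show "real_distribution (distr M borel (S (g n)))" for n
      using S_meas[OF g(1)] by (rule M.real_distribution_distr)
    show "real_distribution (distr M' borel (X (t / 2)))"
      using X_meas \<open>t \<ge> 0\<close> by (intro M'.real_distribution_distr) simp
    fix u
    have I_lim: "(\<lambda>n. I u (g n)) \<longlonglongrightarrow> - ln (1 + u\<^sup>2 / b) / 2"
      using tendsto_truncated_frullani_cos[OF c(1) g, of u] by (simp add: I_def c(2))
    have "filterlim (\<lambda>n. c * g n) (at_right 0) sequentially"
      using tendsto_mult_right_zero[OF g(2), of c] c g(1) by (auto simp: filterlim_at less_imp_neq[symmetric])
    then have "filterlim (\<lambda>n. E1 (c * g n)) at_top sequentially"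
      by (rule filterlim_compose[OF filterlim_E1_at_right_0])
    \<comment> \<open>A convergent numerator over a divergent denominator: the contribution of the
      summand \<open>j = 0\<close> disappears.\<close>
    then have "(\<lambda>n. I u (g n) / E1 (c * g n)) \<longlonglongrightarrow> 0"
      by (intro tendsto_divide_0[OF I_lim] filterlim_at_top_imp_at_infinity)
    then have "(\<lambda>n. char (distr M borel (S (g n))) u) \<longlonglongrightarrow>
        (1 + of_real 0) * exp (of_real (t * a * (- ln (1 + u\<^sup>2 / b) / 2)))"
      unfolding char_S[OF g(1)] by (intro tendsto_intros I_lim)
    \<comment> \<open>The factor 1/2 of the Frullani integral is absorbed into the time, which
      becomes \<open>t / 2\<close>.\<close>
    also have "(1 + of_real 0) * exp (of_real (t * a * (- ln (1 + u\<^sup>2 / b) / 2))) =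
        char (distr M' borel (X (t / 2))) u"
      unfolding exp_of_real using char_X[of u] \<open>t \<ge> 0\<close> by simp
    finally show "(\<lambda>n. char (distr M borel (S (g n))) u) \<longlonglongrightarrow> char (distr M' borel (X (t / 2))) u" .
  qed
  show "weak_conv_filter
      (\<lambda>\<gamma>. distr M borel (\<lambda>\<omega>. \<Sum>j=0..N (t * a * E1 (sqrt b * \<gamma>)) \<omega>. Y \<gamma> j \<omega>))
      (distr M' borel (X (t / 2))) (at_right 0)"
    unfolding weak_conv_filter_def tendsto_at_iff_sequentially
    using conv by (auto simp: weak_conv_m_def weak_conv_def comp_def S_def[abs_def] c_def)
qed

end
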